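(* Let $\Omega\subseteq\mathbb{R}^N$ be a bounded open set with $C^1$ boundary and let $s\in(0,1)$. Let $u\in C(\mathbb{R}^N,\mathbb{R})\cap C^2(\Omega,\mathbb{R})$ with $$\int_{\mathbb{R}^N}\frac{|u(x)|}{1+|x|^{N+2s}}\,dx<\infty.$$ Suppose that $$\begin{cases}\mathcal{L}u\ge 0 & \text{pointwise in }\Omega,\\ u\ge 0 & \text{in }\mathbb{R}^N\setminus\Omega.\end{cases}$$ Then $u\ge 0$ in $\Omega$. Furthermore, if there exists $x_0\in\Omega$ such that $u(x_0)=0$, then $u\equiv 0$ throughout $\mathbb{R}^N$.
   Context: $\mathcal{L}:=-\Delta+(-\Delta)^s$, where $(-\Delta)^s u(x)=c_{N,s}\,\mathrm{P.V.}\int_{\mathbb{R}^N}\frac{u(x)-u(y)}{|x-y|^{N+2s}}\,dy$ and $c_{N,s}=\Big(\int_{\mathbb{R}^N}\frac{1-\cos(\zeta_1)}{|\zeta|^{N+2s}}\,d\zeta\Big)^{-1}$. For $u$ as in the claim, $\mathcal{L}u(x)$ is defined pointwise at every $x\in\Omega$. *)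

theory Defs
  imports "HOL-Analysis.Analysis"
begin

text \<open>
  Throughout, an arbitrary Euclidean space \<open>'a\<close> plays the role of $\mathbb{R}^N$, with
  \<open>N = DIM('a)\<close> and the coordinate directions given by \<open>Basis\<close>.
\<close>

text \<open>Intended for open \<open>S\<close>, on which \<open>at x\<close> and \<open>at x within S\<close> agree.\<close>

definition C1_on :: "'a::euclidean_space set \<Rightarrow> ('a \<Rightarrow> 'b::real_normed_vector) \<Rightarrow> bool" where
  "C1_on S f \<longleftrightarrow> (\<exists>f' :: 'a \<Rightarrow> 'a \<Rightarrow>\<^sub>L 'b.
     (\<forall>x\<in>S. (f has_derivative blinfun_apply (f' x)) (at x)) \<and> continuous_on S f')"

definition C2_on :: "'a::euclidean_space set \<Rightarrow> ('a \<Rightarrow> 'b::real_normed_vector) \<Rightarrow> bool" where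
  "C2_on S f \<longleftrightarrow> (\<exists>f' :: 'a \<Rightarrow> 'a \<Rightarrow>\<^sub>L 'b.
     (\<forall>x\<in>S. (f has_derivative blinfun_apply (f' x)) (at x)) \<and> C1_on S f')"

text \<open>
  Near each boundary point, \<open>\<Omega>\<close> is the region above the graph of a $C^1$ function \<open>\<gamma>\<close>, in
  coordinates whose last axis is the unit vector \<open>e\<close>. A function of the remaining \<open>N - 1\<close>
  coordinates is encoded as a function on the whole space that is constant along \<open>e\<close>.
\<close>

definition C1_boundary :: "'a::euclidean_space set \<Rightarrow> bool" where
  "C1_boundary \<Omega> \<longleftrightarrow> (\<forall>p\<in>frontier \<Omega>. \<exists>r>0. \<exists>e. \<exists>\<gamma> :: 'a \<Rightarrow> real.
     norm e = 1 \<and> C1_on UNIV \<gamma> \<and> (\<forall>x t. \<gamma> (x + t *\<^sub>R e) = \<gamma> x) \<and>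
     \<Omega> \<inter> ball p r = {x \<in> ball p r. \<gamma> x < x \<bullet> e})"

definition partial_deriv :: "'a::euclidean_space \<Rightarrow> ('a \<Rightarrow> real) \<Rightarrow> 'a \<Rightarrow> real" where
  "partial_deriv b f x = deriv (\<lambda>t. f (x + t *\<^sub>R b)) 0"

definition laplacian :: "('a::euclidean_space \<Rightarrow> real) \<Rightarrow> 'a \<Rightarrow> real" where
  "laplacian u x = (\<Sum>b\<in>Basis. partial_deriv b (partial_deriv b u) x)"

text \<open>
  \<open>Basis\<close> is unordered, so the first coordinate is taken to be the one along some chosen basis
  vector; by rotation invariance the value of the integral does not depend on the choice.
\<close>

definition frac_const :: "'a::euclidean_space itself \<Rightarrow> real \<Rightarrow> real" where
  "frac_const _ s = inverse (LINT \<zeta>::'a|lborel.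
     (1 - cos (\<zeta> \<bullet> (SOME b. b \<in> Basis))) / norm \<zeta> powr (real DIM('a) + 2 * s))"

text \<open>
  The principal value is the limit, as \<open>\<epsilon>\<close> decreases to \<open>0\<close>, of the integrals over the
  complement of the ball of radius \<open>\<epsilon>\<close> around \<open>x\<close>. The value of \<open>Lim\<close> is meaningful only where
  this limit exists.
\<close>

definition frac_laplacian :: "real \<Rightarrow> ('a::euclidean_space \<Rightarrow> real) \<Rightarrow> 'a \<Rightarrow> real" where
  "frac_laplacian s u x = frac_const TYPE('a) s *
     Lim (at_right 0) (\<lambda>\<epsilon>. LINT y:- ball x \<epsilon>|lborel.
       (u x - u y) / norm (x - y) powr (real DIM('a) + 2 * s))"

definition mixed_op :: "real \<Rightarrow> ('a::euclidean_space \<Rightarrow> real) \<Rightarrow> 'a \<Rightarrow> real" where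
  "mixed_op s u x = - laplacian u x + frac_laplacian s u x"

end

theory Submission imports Defs
begin

text \<open>
  If \<open>u\<close> takes a global minimum at an interior point \<open>x\<close>, then \<open>laplacian u x \<ge> 0\<close>, and since
  \<open>u y - u x = O(norm (x - y)^2)\<close> there, the principal value is an absolutely convergent integral
  of the nonpositive function \<open>(u x - u y) / norm (x - y) powr (N + 2 * s)\<close>. The inequality
  \<open>mixed_op s u x \<ge> 0\<close> then forces this function to vanish almost everywhere, so \<open>u\<close> is constant.
  A negative minimum over the closure of \<open>\<Omega>\<close> would be such a point, making \<open>u\<close> negative outside
  the bounded set \<open>\<Omega>\<close> as well; an interior zero of a nonnegative \<open>u\<close> is such a point too.
\<close>

section \<open>Integrability of a Levy-type weight\<close>

text \<open>For \<open>q = N + 2 * s\<close> this is the integrand in the Levy condition for the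
  kernel of the fractional Laplacian. It is the common majorant for integrands that vanish
  quadratically at the singularity and stay bounded elsewhere. At \<open>0\<close> its value is
  \<open>0\<close>, by division by zero.\<close>

definition levy_weight :: "real \<Rightarrow> 'a::euclidean_space \<Rightarrow> real" where
  "levy_weight q z = min 1 (norm z ^ 2) / norm z powr q"

lemma levy_weight_nonneg: "levy_weight q z \<ge> 0"
  by (simp add: levy_weight_def)

lemma levy_weight_measurable [measurable]: "levy_weight q \<in> borel_measurable borel"
  unfolding levy_weight_def by measurable

text \<open>The dyadic shells \<open>2^k \<le> norm z < 2^(k+1)\<close> and \<open>2^(-k-1) < norm z \<le> 2^(-k)\<close>.\<close>

lemma levy_weight_le_shell:
  fixes z :: "'a::euclidean_space"
  assumes "q \<ge> 0"
  shows "\<exists>k::nat. levy_weight q z \<le>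
    2 powr (- real k * q) * indicator (cball 0 (2 powr (real k + 1))) z +
    2 powr (q + real k * (q - 2)) * indicator (cball 0 (2 powr (- real k))) z"
proof -
  consider "z = 0" | "norm z \<ge> 1" | "0 < norm z" "norm z < 1"
    by fastforce
  then show ?thesis
  proof cases
    case 1
    then show ?thesis by (simp add: levy_weight_def)
  next
    case 2
    define l where "l = log 2 (norm z)"
    have "norm z > 0" using 2 by linarith
    then have z: "norm z = 2 powr l" by (simp add: l_def)
    have "l \<ge> 0" using 2 \<open>norm z > 0\<close> by (simp add: l_def)
    define k where "k = nat \<lfloor>l\<rfloor>"
    have k: "real k \<le> l" "l < real k + 1"
      using \<open>l \<ge> 0\<close> by (simp_all add: k_def)
    have "norm z powr q \<ge> 2 powr (real k * q)"
      using k assms by (simp add: z powr_powr mult_right_mono)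
    then have "1 / norm z powr q \<le> 1 / 2 powr (real k * q)"
      by (intro divide_left_mono) (use \<open>norm z > 0\<close> in auto)
    then have "levy_weight q z \<le> 2 powr (- real k * q)"
      using 2 by (simp add: levy_weight_def powr_minus field_simps one_le_power)
    moreover have "z \<in> cball 0 (2 powr (real k + 1))" using k by (simp add: z)
    ultimately show ?thesis
      by (intro exI[of _ k]) (auto intro: add_increasing2)
  next
    case 3
    define l where "l = - log 2 (norm z)"
    have z: "norm z = 2 powr (- l)" using 3 by (simp add: l_def)
    have "l \<ge> 0" using 3 by (simp add: l_def)
    define k where "k = nat \<lfloor>l\<rfloor>"
    have k: "real k \<le> l" "l < real k + 1"
      using \<open>l \<ge> 0\<close> by (simp_all add: k_def)
    \<comment> \<open>The numerator is bounded through the outer radius \<open>2 powr (- k)\<close>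
      of the shell, the denominator through the inner radius \<open>2 powr (- k - 1)\<close>. This
      mismatch produces the extra factor \<open>2 powr q\<close>.\<close>
    have sq: "norm z ^ 2 \<le> 2 powr (- 2 * real k)"
      using k by (simp add: z powr_power)
    have "l * q \<le> (real k + 1) * q" using k assms by (intro mult_right_mono) auto
    then have "norm z powr q \<ge> 2 powr (- (real k + 1) * q)"
      by (simp add: z powr_powr algebra_simps)
    then have "norm z ^ 2 / norm z powr q \<le> 2 powr (- 2 * real k) / 2 powr (- (real k + 1) * q)"
      using sq by (intro frac_le) auto
    also have "\<dots> = 2 powr (q + real k * (q - 2))"
      by (simp add: powr_diff[symmetric] algebra_simps)
    finally have "levy_weight q z \<le> 2 powr (q + real k * (q - 2))"
      using 3 by (simp add: levy_weight_def min_absorb2 power_le_one)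
    moreover have "z \<in> cball 0 (2 powr (- real k))" using k by (simp add: z)
    ultimately show ?thesis
      by (intro exI[of _ k]) (auto intro: add_increasing)
  qed
qed

text \<open>Summing the shell bounds over \<open>k\<close> leaves two geometric series, with ratio
  \<open>2 powr (N - q)\<close> at infinity and \<open>2 powr (q - 2 - N)\<close> at the origin. The
  two bounds on \<open>q\<close> say precisely that both ratios are below 1.\<close>

lemma levy_weight_integrable:
  assumes q: "real DIM('a::euclidean_space) < q" "q < real DIM('a) + 2"
  shows "integrable lborel (levy_weight q :: 'a \<Rightarrow> real)"
proof (rule integrableI_nonneg)
  define N where "N = DIM('a)"
  have q': "real N < q" "q < real N + 2" "q \<ge> 0" using q by (simp_all add: N_def)
  define V where "V = unit_ball_vol (real N)"
  have V: "V \<ge> 0" unfolding V_def by (rule unit_ball_vol_nonneg) simp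
  define f where "f = (\<lambda>(k::nat) (z::'a).
    ennreal (2 powr (- real k * q)) * indicator (cball 0 (2 powr (real k + 1))) z +
    ennreal (2 powr (q + real k * (q - 2))) * indicator (cball 0 (2 powr (- real k))) z)"
  \<comment> \<open>The integral of \<open>f k\<close>, computed from the ball volume
    \<open>V * R ^ N\<close> and regrouped so that the powers of \<open>k\<close> appear as
    geometric terms.\<close>
  define b where "b = (\<lambda>k::nat. V * 2 powr real N * (2 powr (real N - q)) ^ k
    + V * 2 powr q * (2 powr (q - 2 - real N)) ^ k)"
  have meas: "(\<lambda>z::'a. ennreal a * indicator (cball 0 R) z) \<in> borel_measurable lborel" for a R
    by (intro borel_measurable_times_ennreal borel_measurable_const borel_measurable_indicator) simp
  have int_cball: "(\<integral>\<^sup>+z. ennreal a * indicator (cball 0 R) z \<partial>(lborel :: 'a measure)) = ennreal (a * (V * R ^ N))"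
    if "a \<ge> 0" "R \<ge> 0" for a R
    using that V
    by (subst nn_integral_cmult_indicator) (simp_all add: emeasure_cball V_def N_def ennreal_mult)
  have int_f: "(\<integral>\<^sup>+z. f k z \<partial>lborel) = ennreal (b k)" for k
  proof -
    have "(\<integral>\<^sup>+z. f k z \<partial>lborel) =
      ennreal (2 powr (- real k * q) * (V * (2 powr (real k + 1)) ^ N)) +
      ennreal (2 powr (q + real k * (q - 2)) * (V * (2 powr (- real k)) ^ N))"
      unfolding f_def by (simp only: nn_integral_add[OF meas meas] int_cball[OF powr_ge_zero powr_ge_zero])
    also have "\<dots> = ennreal (2 powr (- real k * q) * (V * (2 powr (real k + 1)) ^ N) +
       2 powr (q + real k * (q - 2)) * (V * (2 powr (- real k)) ^ N))"
      using V by (intro ennreal_plus[symmetric] mult_nonneg_nonneg zero_le_power powr_ge_zero)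
    also have "2 powr (- real k * q) * (V * (2 powr (real k + 1)) ^ N) +
       2 powr (q + real k * (q - 2)) * (V * (2 powr (- real k)) ^ N) = b k"
    proof -
      have outer: "2 powr (- real k * q) * (2 powr (real k + 1)) ^ N = 2 powr real N * (2 powr (real N - q)) ^ k"
        by (simp add: powr_power algebra_simps flip: powr_add)
      have inner: "2 powr (q + real k * (q - 2)) * (2 powr (- real k)) ^ N
          = 2 powr q * (2 powr (q - 2 - real N)) ^ k"
        by (simp add: powr_power algebra_simps flip: powr_add)
      show ?thesis by (simp only: b_def mult.left_commute[of _ V] outer inner mult.assoc)
    qed
    finally show ?thesis .
  qed
  have "2 powr (real N - q) < 1" "2 powr (q - 2 - real N) < 1"
    using q' by (auto intro: powr_less_one)
  then have sb: "summable b"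
    unfolding b_def by (intro summable_add summable_mult summable_geometric) simp_all
  have nb: "b k \<ge> 0" for k
    unfolding b_def using V
    by (intro add_nonneg_nonneg mult_nonneg_nonneg zero_le_power powr_ge_zero)
  have sum_b: "(\<Sum>k. ennreal (b k)) < \<infinity>"
    unfolding suminf_ennreal2[OF nb sb] by simp
  have "ennreal (levy_weight q z) \<le> (\<Sum>k. f k z)" for z :: 'a
  proof -
    obtain k where k: "levy_weight q z \<le>
      2 powr (- real k * q) * indicator (cball 0 (2 powr (real k + 1))) z +
      2 powr (q + real k * (q - 2)) * indicator (cball 0 (2 powr (- real k))) z"
      using levy_weight_le_shell[OF q'(3)] by blast
    then have "ennreal (levy_weight q z) \<le> f k z"
      by (auto simp: f_def indicator_def ennreal_leI ennreal_neg simp flip: ennreal_plus)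
    also have "\<dots> \<le> (\<Sum>k. f k z)"
      using sum_le_suminf[of "\<lambda>k. f k z" "{k}"] by simp
    finally show ?thesis .
  qed
  then have "(\<integral>\<^sup>+z. ennreal (levy_weight q z) \<partial>(lborel :: 'a measure)) \<le> (\<integral>\<^sup>+z. (\<Sum>k. f k z) \<partial>lborel)"
    by (intro nn_integral_mono)
  also have "\<dots> = (\<Sum>k. ennreal (b k))"
    by (subst nn_integral_suminf) (simp_all only: int_f, simp only: f_def borel_measurable_add[OF meas meas])
  finally show "(\<integral>\<^sup>+z. ennreal (levy_weight q z) \<partial>(lborel :: 'a measure)) < \<infinity>"
    using sum_b by simp
qed (simp_all add: levy_weight_nonneg)

section \<open>Positivity of the normalising constant\<close>

text \<open>The set where \<open>f\<close> does not vanish is open and null, and a nonempty open set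
  is never null.\<close>

lemma continuous_AE_zero_imp_zero:
  fixes f :: "'a::euclidean_space \<Rightarrow> real"
  assumes "continuous_on UNIV f" and "AE x in lborel. f x = 0"
  shows "f x = 0"
proof -
  have "open {x. f x \<noteq> 0}"
    using assms(1) by (intro open_Collect_neq) auto
  moreover have "negligible {x. f x \<noteq> 0}"
    using AE_completion[OF assms(2)]
    using \<open>open {x. f x \<noteq> 0}\<close> AE_iff_null_sets[of "{x. f x \<noteq> 0}" lebesgue]
    by (auto simp: negligible_iff_null_sets)
  ultimately show ?thesis using open_not_negligible by blast
qed

text \<open>Integrability is essential here: a Bochner integral that does not exist is
  \<open>0\<close>, and its inverse would be \<open>0\<close> as well. The majorant is twice the
  Levy weight; strict positivity holds because the continuous numerator is not identically
  zero.\<close>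

lemma frac_const_pos:
  assumes "0 < s" "s < 1"
  shows "frac_const TYPE('a::euclidean_space) s > 0"
proof -
  define q where "q = real DIM('a) + 2 * s"
  define b :: 'a where "b = (SOME b. b \<in> Basis)"
  have b: "b \<in> Basis" unfolding b_def by (rule someI_ex) (use nonempty_Basis in blast)
  define k where "k = (\<lambda>z::'a. (1 - cos (z \<bullet> b)) / norm z powr q)"
  have nonneg: "k z \<ge> 0" for z by (simp add: k_def)
  \<comment> \<open>The half-angle formula reduces both bounds to those on
    \<open>sin (t / 2)\<close>: at most 1, and at most \<open>t / 2\<close> in absolute
    value.\<close>
  have num: "1 - cos t \<le> 2 * min 1 (t ^ 2)" for t :: real
  proof -
    have "1 - cos t = 2 * (sin (t / 2)) ^ 2"
      using cos_double_sin[of "t / 2"] by simp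
    moreover have "(sin (t / 2)) ^ 2 \<le> (t / 2) ^ 2"
      using abs_sin_x_le_abs_x[of "t / 2"] abs_le_square_iff by blast
    moreover have "(t / 2) ^ 2 \<le> t ^ 2" by (simp add: power_divide)
    moreover have "(sin (t / 2)) ^ 2 \<le> 1" by (simp add: abs_square_le_1)
    ultimately show ?thesis by auto
  qed
  have le: "k z \<le> 2 * levy_weight q z" for z
  proof -
    have "\<bar>z \<bullet> b\<bar> \<le> norm z" using b by (rule Basis_le_norm)
    then have "(z \<bullet> b) ^ 2 \<le> norm z ^ 2" by (metis abs_ge_zero power2_abs power_mono)
    then have "1 - cos (z \<bullet> b) \<le> 2 * min 1 (norm z ^ 2)"
      using num[of "z \<bullet> b"] by auto
    then show ?thesis
      unfolding k_def levy_weight_def times_divide_eq_right by (rule divide_right_mono) simp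
  qed
  have int: "integrable lborel k"
  proof (rule Bochner_Integration.integrable_bound)
    show "integrable lborel (\<lambda>z::'a. 2 * levy_weight q z)"
      using assms by (intro integrable_mult_right levy_weight_integrable) (auto simp: q_def)
    show "k \<in> borel_measurable lborel" unfolding k_def by measurable
    show "AE z in lborel. norm (k z) \<le> norm (2 * levy_weight q z)"
      using nonneg le by (intro always_eventually allI) (simp add: levy_weight_nonneg)
  qed
  have "integral\<^sup>L lborel k \<noteq> 0"
  proof
    assume "integral\<^sup>L lborel k = 0"
    then have "AE z in lborel. k z = 0"
      using integral_nonneg_eq_0_iff_AE[OF int] nonneg by auto
    \<comment> \<open>The denominator is zero only at \<open>z = 0\<close>, where the numerator
      vanishes too.\<close>
    then have "AE z in lborel. 1 - cos (z \<bullet> b) = 0"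
      by eventually_elim (auto simp: k_def)
    \<comment> \<open>At \<open>pi *\<^sub>R b\<close> the cosine is \<open>-1\<close>, so the
      numerator equals 2.\<close>
    then have "1 - cos ((pi *\<^sub>R b) \<bullet> b) = 0"
      by (intro continuous_AE_zero_imp_zero[of "\<lambda>z. 1 - cos (z \<bullet> b)"] continuous_intros)
    then show False using b by simp
  qed
  moreover have "integral\<^sup>L lborel k \<ge> 0"
    using nonneg by (intro Bochner_Integration.integral_nonneg)
  ultimately have "integral\<^sup>L lborel k > 0" by linarith
  then show ?thesis
    by (simp add: frac_const_def k_def b_def q_def)
qed

section \<open>Second-order behaviour at an interior minimum\<close>

lemma C2_on_derivatives:
  fixes u :: "'a::euclidean_space \<Rightarrow> real"
  assumes "C2_on \<Omega> u"
  obtains f' f'' where "\<And>x. x \<in> \<Omega> \<Longrightarrow> (u has_derivative blinfun_apply (f' x)) (at x)"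
    and "\<And>x. x \<in> \<Omega> \<Longrightarrow> (f' has_derivative blinfun_apply (f'' x)) (at x)"
  using assms unfolding C2_on_def C1_on_def by blast

text \<open>Each pure second derivative is nonnegative: the gradient vanishes at \<open>x\<close>,
  so a negative second derivative along \<open>b\<close> would make the first derivative negative
  just to the right of \<open>0\<close>, and the mean value theorem would give a value below the
  minimum.\<close>

lemma laplacian_nonneg_at_min:
  fixes u :: "'a::euclidean_space \<Rightarrow> real"
  assumes "open \<Omega>" "C2_on \<Omega> u" "x \<in> \<Omega>" and min: "\<And>y. u x \<le> u y"
  shows "laplacian u x \<ge> 0"
proof -
  obtain f' f'' where
    f': "\<And>x. x \<in> \<Omega> \<Longrightarrow> (u has_derivative blinfun_apply (f' x)) (at x)" and
    f'': "\<And>x. x \<in> \<Omega> \<Longrightarrow> (f' has_derivative blinfun_apply (f'' x)) (at x)"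
    using C2_on_derivatives[OF assms(2)] by blast
  have "partial_deriv b (partial_deriv b u) x \<ge> 0" if "b \<in> Basis" for b
  proof (rule ccontr)
    have along: "((\<lambda>t. u (z + t *\<^sub>R b)) has_real_derivative f' (z + t *\<^sub>R b) b) (at t)"
      if "z + t *\<^sub>R b \<in> \<Omega>" for z t
      unfolding has_field_derivative_def
      by (rule has_derivative_eq_rhs,
          rule has_derivative_compose[of "\<lambda>t. z + t *\<^sub>R b", OF _ f'[OF that]])
         (auto intro!: derivative_eq_intros simp: blinfun.bilinear_simps)
    have pd: "partial_deriv b u z = f' z b" if "z \<in> \<Omega>" for z
      unfolding partial_deriv_def using along[of z 0] that by (auto intro: DERIV_imp_deriv)
    obtain d where d: "d > 0" "ball x d \<subseteq> \<Omega>"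
      using assms(1,3) openE by blast
    have near: "x + t *\<^sub>R b \<in> \<Omega>" if "\<bar>t\<bar> < d" for t
      using d that \<open>b \<in> Basis\<close> by (auto simp: dist_norm subset_iff)
    have f'b: "((\<lambda>t. f' (x + t *\<^sub>R b) b) has_real_derivative f'' x b b) (at 0)"
      unfolding has_field_derivative_def
      by (rule has_derivative_eq_rhs, rule blinfun.FDERIV,
          rule has_derivative_compose[of "\<lambda>t. x + t *\<^sub>R b" _ _ _ f'])
         (auto intro!: derivative_eq_intros f'' \<open>x \<in> \<Omega>\<close> simp: blinfun.bilinear_simps)
    \<comment> \<open>The outer derivative depends on the inner partial derivative at all points
      near \<open>x\<close>, so the two must be identified on a whole segment around
      \<open>x\<close>.\<close>
    have "((\<lambda>t. partial_deriv b u (x + t *\<^sub>R b)) has_real_derivative f'' x b b) (at 0)"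
      by (rule has_field_derivative_transform_within[OF f'b \<open>0 < d\<close>])
         (auto simp: pd near dist_norm)
    then have second: "partial_deriv b (partial_deriv b u) x = f'' x b b"
      unfolding partial_deriv_def[of b "partial_deriv b u"] by (rule DERIV_imp_deriv)
    have f'x: "f' x b = 0"
      using differential_zero_maxmin[OF \<open>x \<in> \<Omega>\<close> \<open>open \<Omega>\<close> f'[OF \<open>x \<in> \<Omega>\<close>]] min by metis
    assume "\<not> partial_deriv b (partial_deriv b u) x \<ge> 0"
    with second have "f'' x b b < 0" by simp
    then obtain e where e: "e > 0" "\<And>h. h > 0 \<Longrightarrow> h < e \<Longrightarrow> f' (x + h *\<^sub>R b) b < 0"
      using DERIV_neg_dec_right[OF f'b] f'x by auto
    define h where "h = min d e / 2"
    have h: "h > 0" "h < d" "h < e" using d e by (auto simp: h_def)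
    obtain z where z: "z > 0" "z < h"
      "u (x + h *\<^sub>R b) - u (x + 0 *\<^sub>R b) = (h - 0) * f' (x + z *\<^sub>R b) b"
      using MVT2[of 0 h "\<lambda>t. u (x + t *\<^sub>R b)" "\<lambda>t. f' (x + t *\<^sub>R b) b"] along near h
      by auto
    have "h * f' (x + z *\<^sub>R b) b < 0"
      using e(2)[of z] z h by (simp add: mult_pos_neg)
    with z(3) min[of "x + h *\<^sub>R b"] show False by simp
  qed
  then show ?thesis unfolding laplacian_def by (intro sum_nonneg)
qed

text \<open>Since \<open>f' x = 0\<close> and \<open>f'\<close> is differentiable at
  \<open>x\<close>, \<open>f'\<close> grows at most linearly away from \<open>x\<close>. Integrating
  this growth, through the mean value inequality, gives the quadratic bound.\<close>

lemma C2_on_quadratic_at_min: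
  fixes u :: "'a::euclidean_space \<Rightarrow> real"
  assumes "open \<Omega>" "C2_on \<Omega> u" "x \<in> \<Omega>" and min: "\<And>y. u x \<le> u y"
  obtains r C where "r > 0" "C \<ge> 0" "\<And>y. norm (x - y) < r \<Longrightarrow> u y - u x \<le> C * norm (x - y) ^ 2"
proof -
  obtain f' f'' where
    f': "\<And>x. x \<in> \<Omega> \<Longrightarrow> (u has_derivative blinfun_apply (f' x)) (at x)" and
    f'': "\<And>x. x \<in> \<Omega> \<Longrightarrow> (f' has_derivative blinfun_apply (f'' x)) (at x)"
    using C2_on_derivatives[OF assms(2)] by blast
  have f'x: "f' x = 0"
    using differential_zero_maxmin[OF \<open>x \<in> \<Omega>\<close> \<open>open \<Omega>\<close> f'[OF \<open>x \<in> \<Omega>\<close>]] min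
    by (intro blinfun_eqI) (metis zero_blinfun.rep_eq)
  obtain d where d: "d > 0" "ball x d \<subseteq> \<Omega>"
    using assms(1,3) openE by blast
  obtain e where e: "e > 0"
    "\<And>y. norm (y - x) < e \<Longrightarrow> norm (f' y - f' x - f'' x (y - x)) \<le> norm (y - x)"
    using f''[OF \<open>x \<in> \<Omega>\<close>, unfolded has_derivative_at_alt] by (metis mult_1 zero_less_one)
  \<comment> \<open>The linear part contributes the operator norm of \<open>f'' x\<close>, and the
    remainder estimate, taken with tolerance 1, contributes the 1.\<close>
  define C where "C = norm (f'' x) + 1"
  have bound: "norm (f' y) \<le> C * norm (y - x)" if "norm (y - x) < e" for y
  proof -
    have "norm (f' y) \<le> norm (f'' x (y - x)) + norm (f' y - f' x - f'' x (y - x))"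
      unfolding f'x by (metis diff_zero norm_triangle_sub add.commute)
    also have "\<dots> \<le> norm (f'' x) * norm (y - x) + norm (y - x)"
      by (intro add_mono norm_blinfun e(2) that)
    finally show ?thesis by (simp add: C_def algebra_simps)
  qed
  show thesis
  proof (rule that[of "min d e" C])
    show "min d e > 0" "C \<ge> 0" using d e by (auto simp: C_def)
    fix y assume y: "norm (x - y) < min d e"
    \<comment> \<open>The closed ball reaching exactly to \<open>y\<close> is convex and contains
      both endpoints, and on it the derivative is bounded by \<open>C * \<rho>\<close>; the second
      factor \<open>\<rho>\<close> comes from the distance of the endpoints.\<close>
    define \<rho> where "\<rho> = norm (x - y)"
    have sub: "z \<in> \<Omega>" "norm (z - x) < e" "norm (z - x) \<le> \<rho>" if "z \<in> cball x \<rho>" for z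
      using that y d by (auto simp: \<rho>_def dist_norm norm_minus_commute subset_iff)
    have "norm (u y - u x) \<le> C * \<rho> * norm (y - x)"
    proof (rule differentiable_bound[of "cball x \<rho>" u "\<lambda>z. blinfun_apply (f' z)"])
      fix z assume z: "z \<in> cball x \<rho>"
      show "(u has_derivative blinfun_apply (f' z)) (at z within cball x \<rho>)"
        using f'[OF sub(1)[OF z]] by (rule has_derivative_at_withinI)
      have "norm (f' z) \<le> C * norm (z - x)" by (rule bound[OF sub(2)[OF z]])
      also have "\<dots> \<le> C * \<rho>" by (intro mult_left_mono sub(3)[OF z] \<open>C \<ge> 0\<close>)
      finally show "onorm (blinfun_apply (f' z)) \<le> C * \<rho>" by (simp add: norm_blinfun.rep_eq)
    qed (auto simp: \<rho>_def dist_norm)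
    then show "u y - u x \<le> C * norm (x - y) ^ 2"
      by (simp add: \<rho>_def power2_eq_square norm_minus_commute mult.assoc)
  qed
qed

section \<open>Integrability of the singular integrand\<close>

lemma integrable_levy_weight_translate:
  assumes "real DIM('a::euclidean_space) < q" "q < real DIM('a) + 2"
  shows "integrable lborel (\<lambda>y. levy_weight q (x - y :: 'a))"
proof -
  have "integrable (distr lborel borel ((+) (- x))) (levy_weight q :: 'a \<Rightarrow> real)"
    unfolding lborel_distr_plus by (rule levy_weight_integrable[OF assms])
  then have "integrable lborel (\<lambda>y. levy_weight q (- x + y))"
    by (subst (asm) integrable_distr_eq) simp_all
  then show ?thesis by (simp add: levy_weight_def norm_minus_commute add.commute)
qed

text \<open>Away from the singularity the numerator of the weight is at least
  \<open>min 1 (r ^ 2)\<close>. This controls the constant part \<open>u x\<close> of the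
  integrand.\<close>

lemma kernel_le_levy_weight:
  assumes "r > 0" "r \<le> norm z"
  shows "1 / norm z powr q \<le> levy_weight q z / min 1 (r ^ 2)"
proof -
  have "r ^ 2 \<le> norm z ^ 2" using assms by (intro power_mono) auto
  then have "min 1 (r ^ 2) \<le> min 1 (norm z ^ 2)" by simp
  moreover have "min 1 (r ^ 2) > 0" using assms by simp
  ultimately have "1 \<le> min 1 (norm z ^ 2) / min 1 (r ^ 2)" by (simp only: le_divide_eq_1_pos)
  then have "1 / norm z powr q \<le> (min 1 (norm z ^ 2) / min 1 (r ^ 2)) / norm z powr q"
    by (rule divide_right_mono) simp
  then show ?thesis by (simp add: levy_weight_def mult.commute)
qed

text \<open>Outside the ball of radius \<open>r\<close>, both 1 and \<open>norm y\<close> are at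
  most a constant times \<open>norm (x - y)\<close>, so the kernel is dominated by the weight of the
  growth hypothesis. This controls the part \<open>u y\<close> of the integrand.\<close>

lemma kernel_le_growth_weight:
  fixes x y :: "'a::euclidean_space"
  assumes "r > 0" "r \<le> norm (x - y)" "q \<ge> 0"
  shows "1 / norm (x - y) powr q \<le>
    (1 / r powr q + (norm x / r + 1) powr q) / (1 + norm y powr q)"
proof -
  define \<rho> where "\<rho> = norm (x - y)"
  have \<rho>: "\<rho> > 0" "r \<le> \<rho>" using assms by (auto simp: \<rho>_def)
  have "norm y \<le> norm x + \<rho>"
    unfolding \<rho>_def by (metis norm_minus_commute norm_triangle_sub)
  also have "norm x \<le> norm x / r * \<rho>"
    using assms \<rho> mult_left_mono[of r \<rho> "norm x / r"] by simp
  finally have "norm y \<le> (norm x / r + 1) * \<rho>" by (simp add: algebra_simps)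
  then have "norm y powr q \<le> ((norm x / r + 1) * \<rho>) powr q"
    using assms by (intro powr_mono2) auto
  also have "\<dots> = (norm x / r + 1) powr q * \<rho> powr q"
    using assms \<rho> by (simp add: powr_mult)
  finally have 1: "norm y powr q \<le> (norm x / r + 1) powr q * \<rho> powr q" .
  have 2: "1 \<le> 1 / r powr q * \<rho> powr q"
    using powr_mono2[of q r \<rho>] assms \<rho> by simp
  have "1 + norm y powr q \<le> (1 / r powr q + (norm x / r + 1) powr q) * \<rho> powr q"
    unfolding distrib_right using 1 2 by (rule add_mono[rotated])
  moreover have "1 + norm y powr q > 0" by (simp add: add_pos_nonneg)
  ultimately show ?thesis
    using \<rho> by (simp add: \<rho>_def[symmetric] divide_simps mult.commute)
qed

text \<open>Near \<open>x\<close> the quadratic bound cancels enough of the singularity for the Levy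
  weight to dominate. Farther away the triangle inequality splits off \<open>u x\<close>, handled by
  the Levy weight, and \<open>u y\<close>, handled by the growth hypothesis.\<close>

lemma frac_integrand_integrable_at_min:
  fixes u :: "'a::euclidean_space \<Rightarrow> real"
  assumes q: "real DIM('a) < q" "q < real DIM('a) + 2"
    and "open \<Omega>" "C2_on \<Omega> u" "x \<in> \<Omega>" and min: "\<And>y. u x \<le> u y"
    and cont: "continuous_on UNIV u"
    and growth: "integrable lborel (\<lambda>y. \<bar>u y\<bar> / (1 + norm y powr q))"
  shows "integrable lborel (\<lambda>y. (u x - u y) / norm (x - y) powr q)"
proof -
  have "q \<ge> 0" using q by linarith
  obtain r C where r: "r > 0" and C: "C \<ge> 0"
    "\<And>y. norm (x - y) < r \<Longrightarrow> u y - u x \<le> C * norm (x - y) ^ 2"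
    using C2_on_quadratic_at_min[OF assms(3-5) min] by blast
  \<comment> \<open>The cap at 1 makes the minimum in \<open>levy_weight\<close> equal to the square
    throughout the near region.\<close>
  define r' where "r' = min r 1"
  have r': "r' > 0" "r' \<le> r" "r' \<le> 1" using r by (auto simp: r'_def)
  define A where "A = C + \<bar>u x\<bar> / min 1 (r' ^ 2)"
  define B where "B = 1 / r' powr q + (norm x / r' + 1) powr q"
  have pos: "\<bar>u x\<bar> / min 1 (r' ^ 2) \<ge> 0" "B \<ge> 0" using r' by (auto simp: B_def)
  have bound: "\<bar>u x - u y\<bar> / norm (x - y) powr q
      \<le> A * levy_weight q (x - y) + B * (\<bar>u y\<bar> / (1 + norm y powr q))" for y
  proof (cases "norm (x - y) < r'")
    case True
    have "norm (x - y) ^ 2 \<le> 1" using True r' by (intro power_le_one) auto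
    then have "\<bar>u x - u y\<bar> \<le> C * min 1 (norm (x - y) ^ 2)"
      using C(2)[of y] min[of y] True r' by (simp add: min_absorb2)
    then have "\<bar>u x - u y\<bar> / norm (x - y) powr q \<le> C * levy_weight q (x - y)"
      unfolding levy_weight_def times_divide_eq_right by (rule divide_right_mono) simp
    also have "\<dots> \<le> A * levy_weight q (x - y)"
      using pos(1) by (intro mult_right_mono levy_weight_nonneg) (simp add: A_def)
    also have "\<dots> \<le> A * levy_weight q (x - y) + B * (\<bar>u y\<bar> / (1 + norm y powr q))"
      using pos(2) by simp
    finally show ?thesis .
  next
    case False
    then have far: "r' \<le> norm (x - y)" by simp
    have "\<bar>u x - u y\<bar> / norm (x - y) powr q
        \<le> \<bar>u x\<bar> * (1 / norm (x - y) powr q) + \<bar>u y\<bar> * (1 / norm (x - y) powr q)"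
      using divide_right_mono[OF abs_triangle_ineq4[of "u x" "u y"], of "norm (x - y) powr q"]
      by (simp add: add_divide_distrib)
    also have "\<dots> \<le> \<bar>u x\<bar> * (levy_weight q (x - y) / min 1 (r' ^ 2))
        + \<bar>u y\<bar> * (B / (1 + norm y powr q))"
      unfolding B_def
      by (intro add_mono mult_left_mono kernel_le_levy_weight kernel_le_growth_weight)
         (use r' far \<open>q \<ge> 0\<close> in auto)
    also have "\<dots> \<le> A * levy_weight q (x - y) + B * (\<bar>u y\<bar> / (1 + norm y powr q))"
      using C(1) levy_weight_nonneg[of q "x - y"] by (simp add: A_def algebra_simps)
    finally show ?thesis .
  qed
  have [measurable]: "u \<in> borel_measurable borel"
    using cont by (rule borel_measurable_continuous_onI)
  show ?thesis
  proof (rule Bochner_Integration.integrable_bound)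
    show "integrable lborel (\<lambda>y. A * levy_weight q (x - y) + B * (\<bar>u y\<bar> / (1 + norm y powr q)))"
      by (intro Bochner_Integration.integrable_add integrable_mult_right
          integrable_levy_weight_translate q growth)
    show "AE y in lborel. norm ((u x - u y) / norm (x - y) powr q) \<le>
        norm (A * levy_weight q (x - y) + B * (\<bar>u y\<bar> / (1 + norm y powr q)))"
      using bound by (intro always_eventually allI) (simp add: order_trans[OF _ abs_ge_self])
  qed measurable
qed

section \<open>Principal value and rigidity at an interior minimum\<close>

text \<open>Dominated convergence with majorant \<open>norm (f y)\<close>: every point other than
  \<open>x\<close> eventually leaves the shrinking balls. The centre is always cut out, and
  \<open>f x = 0\<close> gives convergence there too.\<close>

lemma principal_value_eq_integral:
  fixes f :: "'a::euclidean_space \<Rightarrow> real"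
  assumes int: "integrable lborel f" and "f x = 0"
  shows "Lim (at_right 0) (\<lambda>\<epsilon>. LINT y:- ball x \<epsilon>|lborel. f y) = integral\<^sup>L lborel f"
proof (rule tendsto_Lim)
  show "((\<lambda>\<epsilon>. LINT y:- ball x \<epsilon>|lborel. f y) \<longlongrightarrow> integral\<^sup>L lborel f) (at_right 0)"
  proof (rule tendsto_at_right_sequentially[of 0 1])
    fix S :: "nat \<Rightarrow> real"
    assume S: "S \<longlonglongrightarrow> 0"
    have [measurable]: "f \<in> borel_measurable borel" using int by auto
    show "(\<lambda>n. LINT y:- ball x (S n)|lborel. f y) \<longlonglongrightarrow> integral\<^sup>L lborel f"
      unfolding set_lebesgue_integral_def
    proof (rule integral_dominated_convergence)
      show "integrable lborel (\<lambda>y. norm (f y))" using int by simp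
      show "AE y in lborel. (\<lambda>n. indicator (- ball x (S n)) y *\<^sub>R f y) \<longlonglongrightarrow> f y"
      proof (intro always_eventually allI)
        fix y
        show "(\<lambda>n. indicator (- ball x (S n)) y *\<^sub>R f y) \<longlonglongrightarrow> f y"
        proof (cases "y = x")
          case False
          then have "eventually (\<lambda>n. S n < dist x y) sequentially"
            using order_tendstoD(2)[OF S] by simp
          then show ?thesis
            by (intro tendsto_eventually, eventually_elim) auto
        qed (simp add: \<open>f x = 0\<close>)
      qed
    qed (auto split: split_indicator)
  qed simp
qed simp

text \<open>The local term \<open>- laplacian u x\<close> is nonpositive, so the nonlocal term must
  be nonnegative. Being a positive multiple of the integral of a nonpositive function, it forces
  that function to vanish almost everywhere, and continuity removes the exceptional set.\<close>

lemma constant_if_interior_min: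
  fixes u :: "'a::euclidean_space \<Rightarrow> real"
  assumes "open \<Omega>" "C2_on \<Omega> u" "x \<in> \<Omega>" and min: "\<And>y. u x \<le> u y"
    and s: "0 < s" "s < 1"
    and cont: "continuous_on UNIV u"
    and growth: "integrable lborel (\<lambda>y. \<bar>u y\<bar> / (1 + norm y powr (real DIM('a) + 2 * s)))"
    and super: "mixed_op s u x \<ge> 0"
  shows "u y = u x"
proof -
  define q where "q = real DIM('a) + 2 * s"
  define f where "f = (\<lambda>y. (u x - u y) / norm (x - y) powr q)"
  have int: "integrable lborel f"
    unfolding f_def
    by (rule frac_integrand_integrable_at_min[OF _ _ assms(1-3) min cont])
       (use s growth in \<open>auto simp: q_def\<close>)
  have "frac_laplacian s u x = frac_const TYPE('a) s * integral\<^sup>L lborel f"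
    unfolding frac_laplacian_def
    using principal_value_eq_integral[OF int, of x] by (simp add: f_def q_def)
  then have "frac_const TYPE('a) s * integral\<^sup>L lborel f \<ge> 0"
    using super laplacian_nonneg_at_min[OF assms(1-3) min] by (simp add: mixed_op_def)
  then have "integral\<^sup>L lborel f \<ge> 0"
    using frac_const_pos[OF s, where 'a = 'a] by (simp add: zero_le_mult_iff)
  moreover have nonpos: "f z \<le> 0" for z
    using min[of z] by (simp add: f_def divide_nonpos_nonneg)
  then have "integral\<^sup>L lborel (\<lambda>z. - f z) \<ge> 0"
    by (intro Bochner_Integration.integral_nonneg) simp
  ultimately have "integral\<^sup>L lborel (\<lambda>z. - f z) = 0" by simp
  then have "AE z in lborel. - f z = 0"
    using integral_nonneg_eq_0_iff_AE[of lborel "\<lambda>z. - f z"] int nonpos by auto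
  \<comment> \<open>The degenerate denominator at \<open>z = x\<close> is harmless, as
    \<open>u z - u x\<close> is zero there.\<close>
  then have "AE z in lborel. u z - u x = 0"
    by eventually_elim (auto simp: f_def)
  then have "u y - u x = 0"
    by (rule continuous_AE_zero_imp_zero[rotated]) (intro continuous_intros cont)
  then show ?thesis by simp
qed

theorem theorem1p3:
  fixes \<Omega> :: "'a::euclidean_space set" and s :: real and u :: "'a \<Rightarrow> real"
  assumes "bounded \<Omega>" and "open \<Omega>" and "C1_boundary \<Omega>"
    and "0 < s" and "s < 1"
    and "continuous_on UNIV u" and "C2_on \<Omega> u"
    and "integrable lborel (\<lambda>x. \<bar>u x\<bar> / (1 + norm x powr (real DIM('a) + 2 * s)))"
    and "\<And>x. x \<in> \<Omega> \<Longrightarrow> mixed_op s u x \<ge> 0"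
    and "\<And>x. x \<notin> \<Omega> \<Longrightarrow> u x \<ge> 0"
  shows "(\<forall>x\<in>\<Omega>. u x \<ge> 0) \<and> ((\<exists>x0\<in>\<Omega>. u x0 = 0) \<longrightarrow> (\<forall>x. u x = 0))"
proof -
  have const: "u y = u x" if "x \<in> \<Omega>" "\<And>y. u x \<le> u y" for x y
    using constant_if_interior_min[OF assms(2,7) that assms(4-6,8) assms(9)[OF that(1)]] .
  have nonneg: "\<forall>x\<in>\<Omega>. u x \<ge> 0"
  proof (rule ccontr)
    assume "\<not> ?thesis"
    then obtain x1 where x1: "x1 \<in> \<Omega>" "u x1 < 0" by auto
    have "compact (closure \<Omega>)" using assms(1) by simp
    moreover have "closure \<Omega> \<noteq> {}" using x1 by auto
    moreover have "continuous_on (closure \<Omega>) u" using assms(6) by (rule continuous_on_subset) simp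
    ultimately obtain x where x: "x \<in> closure \<Omega>" "\<And>y. y \<in> closure \<Omega> \<Longrightarrow> u x \<le> u y"
      by (metis continuous_attains_inf)
    have neg: "u x < 0" using x(2)[of x1] x1 closure_subset[of \<Omega>] by auto
    \<comment> \<open>A minimiser over the closure could lie on the boundary, but \<open>u\<close>
      is nonnegative outside \<open>\<Omega>\<close>.\<close>
    then have "x \<in> \<Omega>" using assms(10)[of x] by force
    \<comment> \<open>The minimum over the closure is global, since outside \<open>\<Omega>\<close>
      the values are nonnegative and \<open>u x\<close> is negative.\<close>
    moreover have "u x \<le> u y" for y
      using x(2)[of y] assms(10)[of y] neg closure_subset[of \<Omega>] by force
    ultimately have "u y = u x" for y by (rule const)
    moreover obtain y where "y \<notin> \<Omega>"
      using assms(1) not_bounded_UNIV[where 'a = 'a] by (metis UNIV_eq_I)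
    ultimately show False using assms(10)[of y] neg by (metis not_le)
  qed
  then have "u y \<ge> 0" for y using assms(10) by blast
  then have "u y = 0" if "x0 \<in> \<Omega>" "u x0 = 0" for x0 y
    using const[of x0 y] that by simp
  with nonneg show ?thesis by blast
qed

end
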